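(* Let $n\ge 2$, let $(V_1,\ldots,V_n)$ be an $n$-isometry on a Hilbert space $\mathcal{H}$, and let $V=\prod_{i=1}^n V_i$. Let $\mathcal{W}=\ker V^*$, $\tilde V_i=\prod_{j\ne i}V_j$, $\tilde{\mathcal{W}}_i=\ker \tilde V_i^*\subseteq\mathcal{W}$, and let $\Pi_V:\mathcal{H}\to H^2_{\mathcal{W}}(\mathbb{D})$ be the Wold--von Neumann decomposition of $V$. Then for each $i=1,\ldots,n$, \[ \Pi_V V_i = M_{\Phi_i}\Pi_V , \] where \[ \Phi_i(z)=U_i\big(P_{\tilde{\mathcal{W}}_i}+zP_{\tilde{\mathcal{W}}_i}^{\perp}\big)\qquad (z\in\mathbb{D}), \] and \[ U_i=(P_{\mathcal{W}}V_i+\tilde V_i^* )|_{\mathcal{W}} \] is a unitary operator on $\mathcal{W}$. In particular, $(V_1,\ldots,V_n)$ on $\mathcal{H}$ and $(M_{\Phi_1},\ldots,M_{\Phi_n})$ on $H^2_{\mathcal{W}}(\mathbb{D})$ are unitarily equivalent.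
   Context: An isometry $X$ on a Hilbert space is a shift if $X^{*m}\to 0$ strongly as $m\to\infty$. An $n$-isometry on $\mathcal{H}$ ($n\ge 2$) is an $n$-tuple $(V_1,\ldots,V_n)$ of commuting isometries on $\mathcal{H}$ such that $V=V_1\cdots V_n$ is a shift. For a Hilbert space $\mathcal{E}$, $H^2_{\mathcal{E}}(\mathbb{D})$ is the $\mathcal{E}$-valued Hardy space on the unit disc $\mathbb{D}$, $H^\infty_{\mathcal{B}(\mathcal{E})}(\mathbb{D})$ is the space of bounded $\mathcal{B}(\mathcal{E})$-valued holomorphic functions on $\mathbb{D}$, and for $\Phi\in H^\infty_{\mathcal{B}(\mathcal{E})}(\mathbb{D})$, $M_\Phi$ is the operator $(M_\Phi f)(w)=\Phi(w)f(w)$ on $H^2_{\mathcal{E}}(\mathbb{D})$; $M_z$ is multiplication by the coordinate function. For a shift $X$ on $\mathcal{H}$ with $\mathcal{W}(X)=\ker X^*$ one has $\mathcal{H}=\bigoplus_{m\ge0}X^m\mathcal{W}(X)$, and the Wold--von Neumann decomposition of $X$ is the unitary $\Pi_X:\mathcal{H}\to H^2_{\mathcal{W}(X)}(\mathbb{D})$ determined by $\Pi_X(X^m\eta)=z^m\eta$ for $m\ge0$, $\eta\in\mathcal{W}(X)$. $P_{\mathcal{W}}$ is the orthogonal projection of $\mathcal{H}$ onto $\mathcal{W}$; $P_{\tilde{\mathcal{W}}_i}\in\mathcal{B}(\mathcal{W})$ is the orthogonal projection of $\mathcal{W}$ onto $\tilde{\mathcal{W}}_i$, and $P_{\tilde{\mathcal{W}}_i}^\perp=I_{\mathcal{W}}-P_{\tilde{\mathcal{W}}_i}$.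 Two $n$-tuples $(A_1,\ldots,A_n)$ on $\mathcal{H}$ and $(B_1,\ldots,B_n)$ on $\mathcal{K}$ are unitarily equivalent if there is a unitary $U:\mathcal{H}\to\mathcal{K}$ with $UA_i=B_iU$ for all $i$. *)

theory Defs
  imports "HOL-Analysis.Analysis" "HOL-Library.Function_Algebras"
begin

class complex_vector = ab_group_add +
  fixes scaleC :: "complex \<Rightarrow> 'a \<Rightarrow> 'a"  (infixr "*\<^sub>C" 75)
  assumes scaleC_add_right: "a *\<^sub>C (x + y) = a *\<^sub>C x + a *\<^sub>C y"
    and scaleC_add_left: "(a + b) *\<^sub>C x = a *\<^sub>C x + b *\<^sub>C x"
    and scaleC_scaleC: "a *\<^sub>C (b *\<^sub>C x) = (a * b) *\<^sub>C x"
    and scaleC_one: "1 *\<^sub>C x = x"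

instantiation "fun" :: (type, complex_vector) complex_vector
begin

definition scaleC_fun :: "complex \<Rightarrow> ('a \<Rightarrow> 'b) \<Rightarrow> 'a \<Rightarrow> 'b" where
  "scaleC_fun c f = (\<lambda>x. c *\<^sub>C f x)"

instance
  by standard (auto simp: scaleC_fun_def fun_eq_iff plus_fun_def
      scaleC_add_right scaleC_add_left scaleC_scaleC scaleC_one)

end

text \<open>The inner product is linear in the first and conjugate-linear in the second argument.
  The superclass \<^class>\<open>banach\<close> supplies completeness.\<close>

class complex_hilbert = complex_vector + banach +
  fixes cinner :: "'a \<Rightarrow> 'a \<Rightarrow> complex"
  assumes scaleR_scaleC: "scaleR r x = complex_of_real r *\<^sub>C x"
    and cinner_commute: "cinner x y = cnj (cinner y x)"
    and cinner_add_left: "cinner (x + y) z = cinner x z + cinner y z"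
    and cinner_scaleC_left: "cinner (c *\<^sub>C x) y = c * cinner x y"
    and cinner_self_nonneg: "0 \<le> Re (cinner x x)"
    and norm_eq_sqrt_cinner: "norm x = sqrt (Re (cinner x x))"

text \<open>Operators on a subspace \<open>S\<close> are represented by functions on the ambient type, of which
  only the values on \<open>S\<close> matter.\<close>

definition clinear_on :: "'a::complex_vector set \<Rightarrow> ('a \<Rightarrow> 'b::complex_vector) \<Rightarrow> bool" where
  "clinear_on S T \<longleftrightarrow>
     (\<forall>x\<in>S. \<forall>y\<in>S. T (x + y) = T x + T y) \<and> (\<forall>c. \<forall>x\<in>S. T (c *\<^sub>C x) = c *\<^sub>C T x)"

definition bounded_operator_on :: "'a::complex_hilbert set \<Rightarrow> ('a \<Rightarrow> 'a) \<Rightarrow> bool" where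
  "bounded_operator_on S T \<longleftrightarrow>
     clinear_on S T \<and> T ` S \<subseteq> S \<and> (\<exists>C. \<forall>x\<in>S. norm (T x) \<le> C * norm x)"

definition operator_norm_on :: "'a::complex_hilbert set \<Rightarrow> ('a \<Rightarrow> 'a) \<Rightarrow> real" where
  "operator_norm_on S T = (SUP x\<in>{x\<in>S. norm x \<le> 1}. norm (T x))"

definition cadjoint :: "('a::complex_hilbert \<Rightarrow> 'a) \<Rightarrow> 'a \<Rightarrow> 'a" where
  "cadjoint T = (THE S. \<forall>x y. cinner (T x) y = cinner x (S y))"

definition op_kernel :: "('a::complex_hilbert \<Rightarrow> 'a) \<Rightarrow> 'a set" where
  "op_kernel T = {x. T x = 0}"

definition orth_proj :: "'a::complex_hilbert set \<Rightarrow> 'a \<Rightarrow> 'a" where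
  "orth_proj S x = (THE p. p \<in> S \<and> (\<forall>s\<in>S. cinner (x - p) s = 0))"

definition unitary_between ::
  "'a::complex_vector set \<Rightarrow> ('a \<Rightarrow> 'a \<Rightarrow> complex) \<Rightarrow>
   'b::complex_vector set \<Rightarrow> ('b \<Rightarrow> 'b \<Rightarrow> complex) \<Rightarrow> ('a \<Rightarrow> 'b) \<Rightarrow> bool" where
  "unitary_between S ip S' ip' U \<longleftrightarrow>
     clinear_on S U \<and> bij_betw U S S' \<and> (\<forall>x\<in>S. \<forall>y\<in>S. ip' (U x) (U y) = ip x y)"

definition unitarily_equivalent ::
  "nat \<Rightarrow> 'a::complex_vector set \<Rightarrow> ('a \<Rightarrow> 'a \<Rightarrow> complex) \<Rightarrow> (nat \<Rightarrow> 'a \<Rightarrow> 'a) \<Rightarrow>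
   'b::complex_vector set \<Rightarrow> ('b \<Rightarrow> 'b \<Rightarrow> complex) \<Rightarrow> (nat \<Rightarrow> 'b \<Rightarrow> 'b) \<Rightarrow> bool" where
  "unitarily_equivalent n S ip A S' ip' B \<longleftrightarrow>
     (\<exists>U. unitary_between S ip S' ip' U \<and> (\<forall>i\<in>{1..n}. \<forall>x\<in>S. U (A i x) = B i (U x)))"

definition isometry :: "('a::complex_hilbert \<Rightarrow> 'a) \<Rightarrow> bool" where
  "isometry X \<longleftrightarrow> clinear_on UNIV X \<and> (\<forall>x. norm (X x) = norm x)"

definition shift :: "('a::complex_hilbert \<Rightarrow> 'a) \<Rightarrow> bool" where
  "shift X \<longleftrightarrow> isometry X \<and> (\<forall>x. (\<lambda>m. (cadjoint X ^^ m) x) \<longlonglongrightarrow> 0)"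

definition op_prod :: "(nat \<Rightarrow> 'a \<Rightarrow> 'a) \<Rightarrow> nat list \<Rightarrow> 'a \<Rightarrow> 'a" where
  "op_prod V js = foldr (\<lambda>j T. V j \<circ> T) js id"

definition full_product :: "nat \<Rightarrow> (nat \<Rightarrow> 'a \<Rightarrow> 'a) \<Rightarrow> 'a \<Rightarrow> 'a" where
  "full_product n V = op_prod V [1..<Suc n]"

definition product_omitting :: "nat \<Rightarrow> (nat \<Rightarrow> 'a \<Rightarrow> 'a) \<Rightarrow> nat \<Rightarrow> 'a \<Rightarrow> 'a" where
  "product_omitting n V i = op_prod V (filter (\<lambda>j. j \<noteq> i) [1..<Suc n])"

definition n_isometry :: "nat \<Rightarrow> (nat \<Rightarrow> 'a::complex_hilbert \<Rightarrow> 'a) \<Rightarrow> bool" where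
  "n_isometry n V \<longleftrightarrow>
     (\<forall>i\<in>{1..n}. isometry (V i)) \<and>
     (\<forall>i\<in>{1..n}. \<forall>j\<in>{1..n}. V i \<circ> V j = V j \<circ> V i) \<and>
     shift (full_product n V)"

abbreviation unit_disc :: "complex set" where
  "unit_disc \<equiv> ball 0 1"

text \<open>A function on the disc is represented by its extension by \<open>0\<close>, so that equality of
  functions is equality on the disc. The Hardy space with values in \<open>E\<close> consists of the
  functions \<open>f(z) = (\<Sum>m. z^m a\<^sub>m)\<close> with \<open>a\<^sub>m \<in> E\<close> and \<open>(\<Sum>m. \<parallel>a\<^sub>m\<parallel>^2) < \<infinity>\<close>, and
  carries the \<open>\<ell>^2\<close> inner product of the coefficient sequences.\<close>

definition disc_power_series :: "(nat \<Rightarrow> 'a::complex_hilbert) \<Rightarrow> (complex \<Rightarrow> 'a) \<Rightarrow> bool" where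
  "disc_power_series a f \<longleftrightarrow>
     (\<forall>z\<in>unit_disc. (\<lambda>m. z ^ m *\<^sub>C a m) sums f z) \<and> (\<forall>z. z \<notin> unit_disc \<longrightarrow> f z = 0)"

definition hardy2 :: "'a::complex_hilbert set \<Rightarrow> (complex \<Rightarrow> 'a) set" where
  "hardy2 E = {f. \<exists>a. range a \<subseteq> E \<and> summable (\<lambda>m. (norm (a m))\<^sup>2) \<and> disc_power_series a f}"

definition taylor_coeff :: "(complex \<Rightarrow> 'a::complex_hilbert) \<Rightarrow> nat \<Rightarrow> 'a" where
  "taylor_coeff f = (THE a. disc_power_series a f)"

definition hardy2_inner ::
  "(complex \<Rightarrow> 'a::complex_hilbert) \<Rightarrow> (complex \<Rightarrow> 'a) \<Rightarrow> complex" where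
  "hardy2_inner f g = (\<Sum>m. cinner (taylor_coeff f m) (taylor_coeff g m))"

text \<open>Bounded functions from the disc to the bounded operators on \<open>E\<close> that are
  holomorphic, i.e.\ complex differentiable with respect to the operator norm.\<close>

definition hardy_inf :: "'a::complex_hilbert set \<Rightarrow> (complex \<Rightarrow> 'a \<Rightarrow> 'a) set" where
  "hardy_inf E = {\<Phi>.
     (\<forall>z\<in>unit_disc. bounded_operator_on E (\<Phi> z)) \<and>
     (\<exists>C. \<forall>z\<in>unit_disc. operator_norm_on E (\<Phi> z) \<le> C) \<and>
     (\<forall>z\<in>unit_disc. \<exists>L. bounded_operator_on E L \<and>
        ((\<lambda>h. operator_norm_on E (\<lambda>x. inverse h *\<^sub>C (\<Phi> (z + h) x - \<Phi> z x) - L x)) \<longlongrightarrow> 0)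
          (at 0))}"

definition mult_op ::
  "(complex \<Rightarrow> 'a::complex_hilbert \<Rightarrow> 'a) \<Rightarrow> (complex \<Rightarrow> 'a) \<Rightarrow> complex \<Rightarrow> 'a" where
  "mult_op \<Phi> f = (\<lambda>w. if w \<in> unit_disc then \<Phi> w (f w) else 0)"

definition disc_monomial :: "nat \<Rightarrow> 'a::complex_hilbert \<Rightarrow> complex \<Rightarrow> 'a" where
  "disc_monomial m \<eta> = (\<lambda>z. if z \<in> unit_disc then z ^ m *\<^sub>C \<eta> else 0)"

definition wold_decomposition :: "('a::complex_hilbert \<Rightarrow> 'a) \<Rightarrow> 'a \<Rightarrow> complex \<Rightarrow> 'a" where
  "wold_decomposition X =
     (THE P. unitary_between UNIV cinner (hardy2 (op_kernel (cadjoint X))) hardy2_inner P \<and>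
        (\<forall>m. \<forall>\<eta>\<in>op_kernel (cadjoint X). P ((X ^^ m) \<eta>) = disc_monomial m \<eta>))"

end

theory Submission
  imports Defs
begin

text \<open>Write \<open>A = V\<^sub>i\<close> and \<open>B\<close> for the product of the other factors, so that \<open>V = A B = B A\<close>
  and \<open>V\<^sup>* = B\<^sup>* A\<^sup>* = A\<^sup>* B\<^sup>*\<close>. The projection onto \<open>ker X\<^sup>*\<close> is \<open>I - X X\<^sup>*\<close>
  for every isometry \<open>X\<close>, hence \<open>P\<^sub>W A = A (I - B B\<^sup>*)\<close> and
  \<open>\<Phi>(z) = A (I - B B\<^sup>*) + z B\<^sup>*\<close>. The operator \<open>U = A (I - B B\<^sup>*) + B\<^sup>*\<close> is inverted on
  \<open>W\<close> by the operator with the roles of \<open>A\<close> and \<open>B\<close> exchanged. The Wold decomposition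
  sends \<open>x\<close> to the power series with coefficients \<open>(I - V V\<^sup>*) V\<^sup>*\<^sup>m x\<close>, and the intertwining
  relation is an identity between the coefficients of \<open>A x\<close> and of \<open>x\<close>.

  The adjoint of an isometry exists because its range is closed: project onto the range and
  pull back.\<close>

section \<open>Complex Hilbert spaces\<close>

lemma scaleC_zero_right [simp]: "c *\<^sub>C (0::'a::complex_vector) = 0"
  using scaleC_add_right[of c 0 0] by simp

lemma scaleC_zero_left [simp]: "0 *\<^sub>C (x::'a::complex_vector) = 0"
  using scaleC_add_left[of 0 0 x] by simp

lemma scaleC_minus_right: "c *\<^sub>C (- x) = - (c *\<^sub>C (x::'a::complex_vector))"
  using scaleC_add_right[of c x "- x"] by (simp add: add_eq_0_iff2)

lemma scaleC_diff_right: "c *\<^sub>C (x - y) = c *\<^sub>C x - c *\<^sub>C (y::'a::complex_vector)"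
  using scaleC_add_right[of c x "- y"] by (simp add: scaleC_minus_right)

lemma scaleC_minus_one: "(-1) *\<^sub>C (x::'a::complex_vector) = - x"
  using scaleC_add_left[of 1 "-1" x] by (simp add: scaleC_one eq_neg_iff_add_eq_0 add.commute)

lemma cinner_add_right: "cinner x (y + z) = cinner x y + cinner x z"
  by (metis cinner_commute cinner_add_left complex_cnj_add)

lemma cinner_scaleC_right: "cinner x (c *\<^sub>C y) = cnj c * cinner x y"
  by (metis cinner_commute cinner_scaleC_left complex_cnj_mult)

lemma cinner_zero_left [simp]: "cinner 0 x = 0"
  using cinner_add_left[of 0 0 x] by simp

lemma cinner_zero_right [simp]: "cinner x 0 = 0"
  using cinner_add_right[of x 0 0] by simp

lemma cinner_minus_left: "cinner (- x) y = - cinner x y"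
  using cinner_add_left[of x "- x" y] by (simp add: add_eq_0_iff2)

lemma cinner_minus_right: "cinner x (- y) = - cinner x y"
  using cinner_add_right[of x y "- y"] by (simp add: add_eq_0_iff2)

lemma cinner_diff_left: "cinner (x - y) z = cinner x z - cinner y z"
  using cinner_add_left[of x "- y" z] by (simp add: cinner_minus_left)

lemma cinner_diff_right: "cinner x (y - z) = cinner x y - cinner x z"
  using cinner_add_right[of x y "- z"] by (simp add: cinner_minus_right)

lemmas cinner_simps = cinner_add_left cinner_add_right cinner_diff_left cinner_diff_right
  cinner_scaleC_left cinner_scaleC_right

section \<open>Norm identities and the Cauchy-Schwarz inequality\<close>

lemma cinner_self: "cinner x x = complex_of_real ((norm x)\<^sup>2)"
proof (rule complex_eqI)
  show "Re (cinner x x) = Re (complex_of_real ((norm x)\<^sup>2))"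
    by (simp add: norm_eq_sqrt_cinner cinner_self_nonneg)
  show "Im (cinner x x) = Im (complex_of_real ((norm x)\<^sup>2))"
    using arg_cong[OF cinner_commute[of x x], of Im] by simp
qed

lemma norm_power2_cinner: "(norm x)\<^sup>2 = Re (cinner x x)"
  by (simp add: cinner_self)

lemma cinner_eqI: "(\<And>z. cinner x z = cinner y z) \<Longrightarrow> x = y"
proof -
  assume "\<And>z. cinner x z = cinner y z"
  then have "cinner (x - y) (x - y) = 0"
    by (simp add: cinner_diff_left)
  then show "x = y"
    by (simp add: cinner_self)
qed

lemma cinner_eqI_right: "(\<And>z. cinner z x = cinner z y) \<Longrightarrow> x = y"
  by (rule cinner_eqI) (metis cinner_commute)

lemma norm_scaleC: "norm (c *\<^sub>C x) = cmod c * norm (x::'a::complex_hilbert)"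
proof -
  have "complex_of_real ((norm (c *\<^sub>C x))\<^sup>2) = (c * cnj c) * cinner x x"
    by (simp add: cinner_self[symmetric] cinner_simps del: of_real_power)
  also have "\<dots> = complex_of_real ((cmod c * norm x)\<^sup>2)"
    by (simp add: cinner_self complex_norm_square[symmetric] power_mult_distrib del: of_real_power)
  finally have "(norm (c *\<^sub>C x))\<^sup>2 = (cmod c * norm x)\<^sup>2"
    using of_real_eq_iff by blast
  then show ?thesis by simp
qed

lemma norm_power2_add:
  "(norm (x + y))\<^sup>2 = (norm x)\<^sup>2 + (norm y)\<^sup>2 + 2 * Re (cinner x y)"
proof -
  have "Re (cinner y x) = Re (cinner x y)"
    using cinner_commute[of y x] by simp
  then show ?thesis by (simp add: norm_power2_cinner cinner_simps)
qed

lemma norm_power2_diff: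
  "(norm (x - y))\<^sup>2 = (norm x)\<^sup>2 + (norm y)\<^sup>2 - 2 * Re (cinner x y)"
  using norm_power2_add[of x "- y"] by (simp add: cinner_minus_right)

lemma parallelogram:
  fixes x y :: "'a::complex_hilbert"
  shows "(norm (x + y))\<^sup>2 + (norm (x - y))\<^sup>2 = 2 * (norm x)\<^sup>2 + 2 * (norm y)\<^sup>2"
  by (simp add: norm_power2_add norm_power2_diff)

text \<open>Removing from x its component along y lowers the squared norm by exactly the squared
  length of that component. That the result is nonnegative gives Cauchy-Schwarz; the exact decrease
  shows that a closest point of a subspace leaves an orthogonal residual.\<close>

lemma norm_power2_residual:
  assumes "y \<noteq> 0"
  shows "(norm (x - (cinner x y / (norm y)\<^sup>2) *\<^sub>C y))\<^sup>2
    = (norm x)\<^sup>2 - (cmod (cinner x y))\<^sup>2 / (norm y)\<^sup>2"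
proof -
  let ?c = "cinner x y / (norm y)\<^sup>2"
  have "cnj ?c * cinner x y = complex_of_real ((cmod (cinner x y))\<^sup>2 / (norm y)\<^sup>2)"
    by (simp add: complex_norm_square mult.commute del: of_real_power)
  then have "Re (cinner x (?c *\<^sub>C y)) = (cmod (cinner x y))\<^sup>2 / (norm y)\<^sup>2"
    by (metis cinner_scaleC_right Re_complex_of_real)
  moreover have "(norm (?c *\<^sub>C y))\<^sup>2 = (cmod (cinner x y))\<^sup>2 / (norm y)\<^sup>2"
    using assms by (simp add: norm_scaleC norm_divide norm_mult field_simps power2_eq_square)
  ultimately show ?thesis by (simp add: norm_power2_diff)
qed

lemma Cauchy_Schwarz_cinner: "cmod (cinner x y) \<le> norm x * norm y"
proof (cases "y = 0")
  case False
  have "0 \<le> (norm x)\<^sup>2 - (cmod (cinner x y))\<^sup>2 / (norm y)\<^sup>2"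
    using norm_power2_residual[OF False, of x] by (metis zero_le_power2)
  then have "(cmod (cinner x y))\<^sup>2 \<le> (norm x * norm y)\<^sup>2"
    using False by (simp add: field_simps)
  then show ?thesis by (rule power2_le_imp_le) simp
qed simp

lemma bounded_bilinear_cinner: "bounded_bilinear cinner"
proof
  show "\<exists>K. \<forall>a b. norm (cinner a b) \<le> norm a * norm b * K"
    by (rule exI[of _ 1]) (simp add: Cauchy_Schwarz_cinner)
qed (simp_all add: cinner_simps scaleR_scaleC scaleR_conv_of_real)

section \<open>Orthogonal projection onto closed subspaces\<close>

definition csubspace :: "'a::complex_vector set \<Rightarrow> bool" where
  "csubspace S \<longleftrightarrow> 0 \<in> S \<and> (\<forall>x\<in>S. \<forall>y\<in>S. x + y \<in> S) \<and> (\<forall>c. \<forall>x\<in>S. c *\<^sub>C x \<in> S)"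

lemma csubspace_add: "csubspace S \<Longrightarrow> x \<in> S \<Longrightarrow> y \<in> S \<Longrightarrow> x + y \<in> S"
  and csubspace_scaleC: "csubspace S \<Longrightarrow> x \<in> S \<Longrightarrow> c *\<^sub>C x \<in> S"
  and csubspace_0: "csubspace S \<Longrightarrow> 0 \<in> S"
  by (auto simp: csubspace_def)

lemma csubspace_diff: "csubspace S \<Longrightarrow> x \<in> S \<Longrightarrow> y \<in> S \<Longrightarrow> x - y \<in> S"
  using csubspace_add[of S x "(-1) *\<^sub>C y"] csubspace_scaleC[of S y "-1"]
  by (simp add: scaleC_minus_one)

text \<open>Two candidates differ by a vector of S that is orthogonal to S, hence to itself. No
  closedness is involved: the candidate p is already in hand.\<close>

lemma orth_proj_eqI:
  assumes "csubspace S" "p \<in> S" "\<And>s. s \<in> S \<Longrightarrow> cinner (x - p) s = 0"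
  shows "orth_proj S x = p"
  unfolding orth_proj_def
proof (rule the_equality)
  show "p \<in> S \<and> (\<forall>s\<in>S. cinner (x - p) s = 0)"
    using assms by blast
next
  fix q assume q: "q \<in> S \<and> (\<forall>s\<in>S. cinner (x - q) s = 0)"
  then have "q - p \<in> S"
    using assms csubspace_diff by blast
  then have "cinner (x - p) (q - p) - cinner (x - q) (q - p) = 0"
    using assms q by simp
  then have "cinner (q - p) (q - p) = 0"
    by (simp add: cinner_diff_left)
  then show "q = p"
    by (simp add: cinner_self)
qed

text \<open>Closest-point argument: a sequence in S minimising the distance to x is Cauchy by the
  parallelogram law, its limit stays in S, and minimality forces the residual to be orthogonal to
  S.\<close>

lemma closed_csubspace_projection_exists:
  fixes S :: "'a::complex_hilbert set"
  assumes S: "csubspace S" and "closed S"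
  obtains p where "p \<in> S" "\<And>s. s \<in> S \<Longrightarrow> cinner (x - p) s = 0"
proof -
  define D where "D = (\<lambda>s. (norm (x - s))\<^sup>2) ` S"
  define d where "d = Inf D"
  have "D \<noteq> {}"
    using csubspace_0[OF S] by (auto simp: D_def)
  have bdd: "bdd_below D"
    by (rule bdd_belowI[of _ 0]) (auto simp: D_def)
  have d_le: "d \<le> (norm (x - s))\<^sup>2" if "s \<in> S" for s
    unfolding d_def using that bdd by (intro cInf_lower) (auto simp: D_def)
  have "\<exists>s\<in>S. (norm (x - s))\<^sup>2 < d + inverse (real (Suc n))" for n
  proof -
    have "Inf D < d + inverse (real (Suc n))"
      by (simp add: d_def)
    then show ?thesis
      using cInf_lessD[OF \<open>D \<noteq> {}\<close>] by (auto simp: D_def)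
  qed
  then obtain s where s: "\<And>n. s n \<in> S"
      "\<And>n. (norm (x - s n))\<^sup>2 < d + inverse (real (Suc n))"
    by metis
  \<comment> \<open>The midpoint \<open>?h\<close> lies in S, so its squared distance from x is at
    least d. In the parallelogram law the contributions of d cancel and only the error terms
    remain.\<close>
  have close: "(norm (s m - s n))\<^sup>2 \<le> 4 * inverse (real (Suc N))" if "N \<le> m" "N \<le> n" for m n N
  proof -
    let ?h = "(1/2::complex) *\<^sub>C (s m + s n)"
    have "?h \<in> S"
      using S s csubspace_add csubspace_scaleC by blast
    have "?h = (1/2::real) *\<^sub>R (s m + s n)"
      by (simp add: scaleR_scaleC)
    then have "(x - s n) + (x - s m) = (2::real) *\<^sub>R (x - ?h)"
      by (simp add: algebra_simps scaleR_2)
    then have "(norm ((x - s n) + (x - s m)))\<^sup>2 = 4 * (norm (x - ?h))\<^sup>2"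
      by (simp add: power_mult_distrib)
    moreover have "(x - s n) - (x - s m) = s m - s n"
      by simp
    ultimately have "(norm (s m - s n))\<^sup>2
        = 2 * (norm (x - s n))\<^sup>2 + 2 * (norm (x - s m))\<^sup>2 - 4 * (norm (x - ?h))\<^sup>2"
      using parallelogram[of "x - s n" "x - s m"] by simp
    moreover have "inverse (real (Suc m)) \<le> inverse (real (Suc N))"
        "inverse (real (Suc n)) \<le> inverse (real (Suc N))"
      using that by simp_all
    ultimately show ?thesis
      using s(2)[of m] s(2)[of n] d_le[OF \<open>?h \<in> S\<close>] by linarith
  qed
  have "Cauchy s"
  proof (rule CauchyI)
    fix e :: real assume "0 < e"
    then obtain N where "inverse (real (Suc N)) < e\<^sup>2 / 4"
      using reals_Archimedean[of "e\<^sup>2 / 4"] by auto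
    then have "norm (s m - s n) < e" if "N \<le> m" "N \<le> n" for m n
      using close[OF that] \<open>0 < e\<close> by (intro power2_less_imp_less[of _ e]) auto
    then show "\<exists>M. \<forall>m\<ge>M. \<forall>n\<ge>M. norm (s m - s n) < e"
      by blast
  qed
  then obtain p where p: "s \<longlonglongrightarrow> p"
    using Cauchy_convergent_iff convergent_def by blast
  have "p \<in> S"
    using closed_sequentially[OF \<open>closed S\<close>] s(1) p by blast
  have "(\<lambda>n. (norm (x - s n))\<^sup>2) \<longlonglongrightarrow> (norm (x - p))\<^sup>2"
    by (intro tendsto_intros p)
  moreover have "(\<lambda>n. d + inverse (real (Suc n))) \<longlonglongrightarrow> d + 0"
    by (intro tendsto_intros LIMSEQ_inverse_real_of_nat)
  ultimately have min: "(norm (x - p))\<^sup>2 \<le> d"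
    using s(2) by (intro LIMSEQ_le[of _ _ _ d]) (auto intro: less_imp_le)
  have "cinner (x - p) t = 0" if "t \<in> S" for t
  proof (cases "t = 0")
    case False
    \<comment> \<open>\<open>?c *\<^sub>C t\<close> is the component of x - p along t; moving p by
      it stays in S, so it cannot decrease the distance, and the component must vanish.\<close>
    let ?c = "cinner (x - p) t / (norm t)\<^sup>2"
    have "p + ?c *\<^sub>C t \<in> S"
      using S \<open>p \<in> S\<close> \<open>t \<in> S\<close> csubspace_add csubspace_scaleC by blast
    then have "(norm (x - p))\<^sup>2 \<le> (norm (x - p - ?c *\<^sub>C t))\<^sup>2"
      using order_trans[OF min d_le] by (simp only: diff_diff_eq)
    then have "(cmod (cinner (x - p) t))\<^sup>2 / (norm t)\<^sup>2 \<le> 0"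
      unfolding norm_power2_residual[OF False] by linarith
    then show ?thesis
      using False by (simp add: divide_le_0_iff)
  qed simp
  then show thesis
    using that \<open>p \<in> S\<close> by blast
qed

section \<open>Isometries and their adjoints\<close>

lemma clinear_on_subset: "clinear_on UNIV T \<Longrightarrow> clinear_on S T"
  by (auto simp: clinear_on_def)

lemma clinear_bounded_linear:
  fixes T :: "'a::complex_hilbert \<Rightarrow> 'b::complex_hilbert"
  assumes "clinear_on UNIV T" "\<And>x. norm (T x) \<le> C * norm x"
  shows "bounded_linear T"
  using assms unfolding clinear_on_def
  by (intro bounded_linear_intro[of _ C]) (auto simp: scaleR_scaleC mult.commute)

lemma clinear_simps:
  assumes "clinear_on UNIV T"
  shows "T (x + y) = T x + T y" "T (c *\<^sub>C x) = c *\<^sub>C T x" "T (x - y) = T x - T y" "T 0 = 0"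
proof -
  show add: "T (x + y) = T x + T y" for x y
    using assms by (simp add: clinear_on_def)
  show "T (c *\<^sub>C x) = c *\<^sub>C T x"
    using assms by (simp add: clinear_on_def)
  show "T (x - y) = T x - T y"
    using add[of "x - y" y] by simp
  show "T 0 = 0"
    using add[of 0 0] by simp
qed

lemma cadjoint_eqI:
  assumes "\<And>x y. cinner (T x) y = cinner x (S y)"
  shows "cadjoint T = S"
  unfolding cadjoint_def
proof (rule the_equality)
  fix S' assume "\<forall>x y. cinner (T x) y = cinner x (S' y)"
  then show "S' = S"
    using assms by (metis cinner_eqI_right ext)
qed (use assms in blast)

text \<open>Polarisation: norms of sums determine the real part of the inner product, and the
  imaginary part is the real part with y replaced by i y.\<close>

lemma isometry_cinner:
  assumes "isometry X"
  shows "cinner (X x) (X y) = cinner x y"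
proof -
  have lin: "clinear_on UNIV X" and nrm: "\<And>x. norm (X x) = norm x"
    using assms by (auto simp: isometry_def)
  have re: "Re (cinner (X x) (X y)) = Re (cinner x y)" for x y
    using norm_power2_add[of "X x" "X y"] norm_power2_add[of x y]
    by (simp add: nrm clinear_simps(1)[OF lin, symmetric])
  have "Im (cinner x y) = Re (cinner x (\<i> *\<^sub>C y))" for x y :: 'a
    by (simp add: cinner_scaleC_right)
  then have "Im (cinner (X x) (X y)) = Im (cinner x y)"
    using re[of x "\<i> *\<^sub>C y"] by (simp add: clinear_simps(2)[OF lin])
  with re show ?thesis
    by (simp add: complex_eqI)
qed

lemma isometry_closed_range:
  assumes "isometry X"
  shows "closed (range X)"
proof -
  have lin: "clinear_on UNIV X" and nrm: "\<And>x. norm (X x) = norm x"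
    using assms by (auto simp: isometry_def)
  have "bounded_linear X"
    using clinear_bounded_linear[OF lin, of 1] nrm by simp
  then have "complete (range X)"
    using complete_isometric_image[of 1 UNIV X] nrm by (simp add: complete_UNIV)
  then show ?thesis
    by (rule complete_imp_closed)
qed

lemma csubspace_range:
  assumes "clinear_on UNIV X"
  shows "csubspace (range X)"
  unfolding csubspace_def
proof (intro conjI ballI allI)
  show "0 \<in> range X"
    using clinear_simps(4)[OF assms] by (metis rangeI)
  show "x + y \<in> range X" if "x \<in> range X" "y \<in> range X" for x y
    using that by (auto simp: clinear_simps(1)[OF assms, symmetric])
  show "c *\<^sub>C x \<in> range X" if "x \<in> range X" for c x
    using that by (auto simp: clinear_simps(2)[OF assms, symmetric])
qed

text \<open>\<open>cadjoint\<close> is a definite description, so a function satisfying this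
  equation has to be exhibited. If X w is the projection of y onto the range of X, then pairing X x
  with y is pairing X x with X w, that is x with w.\<close>

lemma cinner_cadjoint:
  assumes "isometry X"
  shows "cinner (X x) y = cinner x (cadjoint X y)"
proof -
  have lin: "clinear_on UNIV X"
    using assms by (auto simp: isometry_def)
  have "\<exists>w. \<forall>x. cinner (X x) y = cinner x w" for y
  proof -
    obtain p where p: "p \<in> range X" "\<And>s. s \<in> range X \<Longrightarrow> cinner (y - p) s = 0"
      using closed_csubspace_projection_exists[OF csubspace_range[OF lin]
          isometry_closed_range[OF assms]] by blast
    then obtain w where w: "p = X w"
      by blast
    have "cinner (X x) y = cinner x w" for x
    proof -
      have "cinner y (X x) = cinner (X w) (X x)"
        using p(2)[of "X x"] by (simp add: w cinner_diff_left)
      then show ?thesis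
        by (metis assms cinner_commute isometry_cinner)
    qed
    then show ?thesis by blast
  qed
  then obtain S where "\<And>x y. cinner (X x) y = cinner x (S y)"
    by metis
  then show ?thesis
    using cadjoint_eqI by metis
qed

lemma cinner_cadjoint_left: "isometry X \<Longrightarrow> cinner (cadjoint X x) y = cinner x (X y)"
  by (metis cinner_cadjoint cinner_commute)

lemma cadjoint_clinear:
  assumes "isometry X"
  shows "clinear_on UNIV (cadjoint X)"
  unfolding clinear_on_def
proof (intro conjI ballI allI)
  show "cadjoint X (x + y) = cadjoint X x + cadjoint X y" for x y
    by (rule cinner_eqI) (simp add: assms cinner_cadjoint_left cinner_add_left)
  show "cadjoint X (c *\<^sub>C x) = c *\<^sub>C cadjoint X x" for c x
    by (rule cinner_eqI) (simp add: assms cinner_cadjoint_left cinner_scaleC_left)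
qed

lemma cadjoint_isometry_cancel: "isometry X \<Longrightarrow> cadjoint X (X x) = x"
  by (rule cinner_eqI) (simp add: cinner_cadjoint_left isometry_cinner)

lemma norm_cadjoint_le: "isometry X \<Longrightarrow> norm (cadjoint X x) \<le> norm x"
proof -
  assume X: "isometry X"
  have "(norm (cadjoint X x))\<^sup>2 = Re (cinner (X (cadjoint X x)) x)"
    by (simp add: norm_power2_cinner cinner_cadjoint[OF X])
  also have "\<dots> \<le> norm (cadjoint X x) * norm x"
    using order_trans[OF complex_Re_le_cmod Cauchy_Schwarz_cinner[of "X (cadjoint X x)" x]] X
    by (simp add: isometry_def)
  finally show ?thesis
    by (cases "cadjoint X x = 0") (auto simp: power2_eq_square)
qed

lemma isometry_comp: "isometry X \<Longrightarrow> isometry Y \<Longrightarrow> isometry (X \<circ> Y)"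
  by (auto simp: isometry_def clinear_on_def)

lemma isometry_id: "isometry id"
  by (auto simp: isometry_def clinear_on_def)

lemma isometry_funpow: "isometry X \<Longrightarrow> isometry (X ^^ m)"
  by (induction m) (simp_all add: isometry_id isometry_comp)

lemma cadjoint_comp:
  assumes "isometry X" "isometry Y"
  shows "cadjoint (X \<circ> Y) x = cadjoint Y (cadjoint X x)"
proof -
  have "cadjoint (X \<circ> Y) = cadjoint Y \<circ> cadjoint X"
    by (rule cadjoint_eqI) (simp add: assms cinner_cadjoint)
  then show ?thesis by simp
qed

lemma csubspace_op_kernel: "clinear_on UNIV T \<Longrightarrow> csubspace (op_kernel T)"
  by (simp add: csubspace_def op_kernel_def clinear_simps)

text \<open>Since X* X = I, the vector x - X X* x lies in ker X*; the remainder X X* x is in the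
  range of X, which is orthogonal to ker X*.\<close>

lemma orth_proj_ker_cadjoint:
  assumes X: "isometry X"
  shows "orth_proj (op_kernel (cadjoint X)) x = x - X (cadjoint X x)"
proof (rule orth_proj_eqI)
  show "csubspace (op_kernel (cadjoint X))"
    by (simp add: X cadjoint_clinear csubspace_op_kernel)
  show "x - X (cadjoint X x) \<in> op_kernel (cadjoint X)"
    by (simp add: op_kernel_def clinear_simps[OF cadjoint_clinear[OF X]]
        cadjoint_isometry_cancel[OF X])
  show "cinner (x - (x - X (cadjoint X x))) s = 0" if "s \<in> op_kernel (cadjoint X)" for s
    using that by (simp add: op_kernel_def cinner_cadjoint[OF X])
qed

section \<open>The Hardy space\<close>

definition disc_series :: "(nat \<Rightarrow> 'a::complex_hilbert) \<Rightarrow> complex \<Rightarrow> 'a" where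
  "disc_series a = (\<lambda>z. if z \<in> unit_disc then \<Sum>m. z ^ m *\<^sub>C a m else 0)"

lemma disc_power_series_disc_series:
  assumes "\<And>m. norm (a m) \<le> K"
  shows "disc_power_series a (disc_series a)"
  unfolding disc_power_series_def
proof (intro conjI ballI allI impI)
  fix z :: complex assume z: "z \<in> unit_disc"
  have "summable (\<lambda>m. K * cmod z ^ m)"
    using z by (intro summable_mult summable_geometric) simp
  then have "summable (\<lambda>m. z ^ m *\<^sub>C a m)"
    by (rule summable_comparison_test')
      (simp add: norm_scaleC norm_power assms mult.commute[of _ "norm (a _)"] mult_right_mono)
  then show "(\<lambda>m. z ^ m *\<^sub>C a m) sums disc_series a z"
    using z by (simp add: disc_series_def summable_sums)
qed (simp add: disc_series_def)

lemma square_summable_bounded: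
  fixes a :: "nat \<Rightarrow> 'a::real_normed_vector"
  assumes "summable (\<lambda>m. (norm (a m))\<^sup>2)"
  obtains K where "\<And>m. norm (a m) \<le> K"
proof
  fix m
  have "(norm (a m))\<^sup>2 \<le> (\<Sum>m. (norm (a m))\<^sup>2)"
    using sum_le_suminf[OF assms, of "{m}"] by simp
  then show "norm (a m) \<le> sqrt (\<Sum>m. (norm (a m))\<^sup>2)"
    by (rule real_le_rsqrt)
qed

text \<open>Once the coefficients below m vanish, the series can be divided by z^m. The quotient
  sums to 0 on the punctured disc, and its limit at 0 is the coefficient with index m.\<close>

lemma power_series_coeff_zero:
  fixes a :: "nat \<Rightarrow> complex"
  assumes "\<And>z. z \<in> unit_disc \<Longrightarrow> (\<lambda>m. z ^ m * a m) sums 0"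
  shows "a m = 0"
proof (induction m rule: less_induct)
  case (less m)
  have "(\<lambda>n. a (n + m) * z ^ n) sums 0" if "z \<noteq> 0" "norm z < 1" for z
  proof -
    have "(\<lambda>n. z ^ (n + m) * a (n + m)) sums 0"
      using sums_split_initial_segment[OF assms[of z], of m] that less by simp
    from sums_mult[OF this, of "inverse (z ^ m)"] show ?thesis
      using that by (simp add: power_add field_simps)
  qed
  then have "((\<lambda>_. 0) \<longlongrightarrow> a m) (at (0::complex))"
    using powser_limit_0_strong[of 1 "\<lambda>n. a (n + m)" "\<lambda>_. 0"] by simp
  then show ?case
    by (simp add: tendsto_const_iff)
qed

text \<open>Pairing the difference of the two series with a fixed vector v reduces the claim to
  scalar power series.\<close>

lemma disc_power_series_unique:
  assumes "disc_power_series a f" "disc_power_series b f"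
  shows "a = b"
proof
  fix m
  have "cinner (a m - b m) v = 0" for v
  proof (rule power_series_coeff_zero)
    fix z :: complex assume "z \<in> unit_disc"
    then have "(\<lambda>m. z ^ m *\<^sub>C a m - z ^ m *\<^sub>C b m) sums (f z - f z)"
      using assms by (intro sums_diff) (auto simp: disc_power_series_def)
    then have "(\<lambda>m. cinner (z ^ m *\<^sub>C a m - z ^ m *\<^sub>C b m) v) sums cinner (f z - f z) v"
      by (rule bounded_linear.sums[OF bounded_bilinear.bounded_linear_left[OF
            bounded_bilinear_cinner]])
    then show "(\<lambda>m. z ^ m * cinner (a m - b m) v) sums 0"
      by (simp add: cinner_simps right_diff_distrib)
  qed
  then show "a m = b m"
    by (metis cinner_eqI cinner_zero_left eq_iff_diff_eq_0)
qed

lemma taylor_coeff_eqI: "disc_power_series a f \<Longrightarrow> taylor_coeff f = a"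
  unfolding taylor_coeff_def using disc_power_series_unique by blast

lemma disc_power_series_eqI:
  assumes "disc_power_series a f" "disc_power_series a g"
  shows "f = g"
proof
  fix z
  show "f z = g z"
    using assms sums_unique2[of "\<lambda>m. z ^ m *\<^sub>C a m" "f z" "g z"]
    unfolding disc_power_series_def by (cases "z \<in> unit_disc") auto
qed

lemma disc_power_series_monomial:
  "disc_power_series (\<lambda>k. if k = m then \<eta> else 0) (disc_monomial m \<eta>)"
proof -
  have "(\<lambda>k. z ^ k *\<^sub>C (if k = m then \<eta> else 0)) = (\<lambda>k. if k = m then z ^ k *\<^sub>C \<eta> else 0)" for z
    by auto
  then show ?thesis
    using sums_single[of m "\<lambda>k. z ^ k *\<^sub>C \<eta>" for z]
    by (simp add: disc_power_series_def disc_monomial_def)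
qed

lemma hardy2E:
  assumes "f \<in> hardy2 E"
  obtains a where "disc_power_series a f" "taylor_coeff f = a" "\<And>m. a m \<in> E"
    "summable (\<lambda>m. (norm (a m))\<^sup>2)" "f = disc_series a"
proof -
  obtain a where a: "range a \<subseteq> E" "summable (\<lambda>m. (norm (a m))\<^sup>2)" "disc_power_series a f"
    using assms by (auto simp: hardy2_def)
  moreover obtain K where "\<And>m. norm (a m) \<le> K"
    using square_summable_bounded[OF a(2)] by blast
  ultimately show thesis
    using that[OF a(3) taylor_coeff_eqI[OF a(3)]]
      disc_power_series_eqI[OF a(3) disc_power_series_disc_series] by blast
qed

section \<open>The Wold--von Neumann decomposition\<close>

text \<open>Applying \<open>X ^^ m\<close> to this vector gives the component of x in the summand
  X^m ker X* of the Wold decomposition.\<close>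

definition wold_coeff :: "('a::complex_hilbert \<Rightarrow> 'a) \<Rightarrow> 'a \<Rightarrow> nat \<Rightarrow> 'a" where
  "wold_coeff X x m = (cadjoint X ^^ m) x - X ((cadjoint X ^^ Suc m) x)"

definition wold_map :: "('a::complex_hilbert \<Rightarrow> 'a) \<Rightarrow> 'a \<Rightarrow> complex \<Rightarrow> 'a" where
  "wold_map X x = disc_series (wold_coeff X x)"

locale shift_operator =
  fixes X :: "'a::complex_hilbert \<Rightarrow> 'a"
  assumes shift: "shift X"
begin

lemma iso: "isometry X"
  using shift by (simp add: shift_def)

lemma lin: "clinear_on UNIV X"
  using iso by (simp add: isometry_def)

lemmas X_simps = clinear_simps[OF lin]
lemmas adj_simps = clinear_simps[OF cadjoint_clinear[OF iso]]

lemma adj_funpow_clinear: "clinear_on UNIV (cadjoint X ^^ m)"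
  by (induction m) (auto simp: clinear_on_def adj_simps)

lemmas adj_funpow_simps = clinear_simps[OF adj_funpow_clinear]

lemma norm_adj_funpow_le: "norm ((cadjoint X ^^ m) x) \<le> norm x"
  by (induction m) (auto intro: order_trans[OF norm_cadjoint_le[OF iso]])

lemma cinner_adj_funpow: "cinner ((cadjoint X ^^ m) x) y = cinner x ((X ^^ m) y)"
  by (induction m arbitrary: y) (simp_all add: cinner_cadjoint_left[OF iso] funpow_swap1[of X])

section \<open>Coefficients of a vector with respect to a shift\<close>

lemma wold_coeff_clinear: "clinear_on UNIV (\<lambda>x. wold_coeff X x m)"
  unfolding clinear_on_def wold_coeff_def
  by (simp add: adj_funpow_simps adj_simps X_simps scaleC_diff_right)

lemma wold_coeff_in_kernel: "wold_coeff X x m \<in> op_kernel (cadjoint X)"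
  by (simp add: wold_coeff_def op_kernel_def adj_simps cadjoint_isometry_cancel[OF iso])

text \<open>I - X X* is an orthogonal projection, so only one factor of it survives in the inner
  product; what remains is a telescoping difference.\<close>

lemma cinner_wold_coeff:
  "cinner (wold_coeff X x m) (wold_coeff X y m) =
    cinner ((cadjoint X ^^ m) x) ((cadjoint X ^^ m) y)
    - cinner ((cadjoint X ^^ Suc m) x) ((cadjoint X ^^ Suc m) y)"
proof -
  have "cinner u (X (cadjoint X v)) = cinner (cadjoint X u) (cadjoint X v)"
    and "cinner (X (cadjoint X u)) v = cinner (cadjoint X u) (cadjoint X v)" for u v
    by (simp_all add: cinner_cadjoint[OF iso] cinner_cadjoint_left[OF iso])
  then show ?thesis
    by (simp add: wold_coeff_def cinner_simps isometry_cinner[OF iso]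
        adj_simps cadjoint_isometry_cancel[OF iso])
qed

text \<open>Parseval identity. The telescoping sum leaves the term at m = 0 minus the limit, and the
  limit is 0 by the strong convergence of the powers of X* for a shift. This is the only direct use
  of that convergence.\<close>

lemma wold_coeff_sums: "(\<lambda>m. cinner (wold_coeff X x m) (wold_coeff X y m)) sums cinner x y"
proof -
  have "(\<lambda>m. (cadjoint X ^^ m) x) \<longlonglongrightarrow> 0" for x
    using shift by (simp add: shift_def)
  then have "(\<lambda>m. cinner ((cadjoint X ^^ m) x) ((cadjoint X ^^ m) y)) \<longlonglongrightarrow> cinner (0::'a) 0"
    by (intro bounded_bilinear.tendsto[OF bounded_bilinear_cinner]) auto
  then show ?thesis
    using telescope_sums'[of "\<lambda>m. cinner ((cadjoint X ^^ m) x) ((cadjoint X ^^ m) y)" 0]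
    by (simp add: cinner_wold_coeff)
qed

lemma wold_coeff_square_summable: "summable (\<lambda>m. (norm (wold_coeff X x m))\<^sup>2)"
proof -
  have "(\<lambda>m. complex_of_real ((norm (wold_coeff X x m))\<^sup>2)) sums complex_of_real ((norm x)\<^sup>2)"
    using wold_coeff_sums[of x x] unfolding cinner_self .
  then show ?thesis
    unfolding sums_of_real_iff by (rule sums_summable)
qed

lemma norm_wold_coeff_le: "norm (wold_coeff X x m) \<le> norm x"
proof -
  have "(norm (wold_coeff X x m))\<^sup>2 \<le> (norm ((cadjoint X ^^ m) x))\<^sup>2"
    using cinner_wold_coeff[of x m x] unfolding cinner_self of_real_diff[symmetric] of_real_eq_iff
    by simp
  then show ?thesis
    using norm_adj_funpow_le power2_le_imp_le norm_ge_zero order_trans by metis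
qed

lemma wold_map_series: "disc_power_series (wold_coeff X x) (wold_map X x)"
  unfolding wold_map_def by (rule disc_power_series_disc_series, rule norm_wold_coeff_le)

lemma wold_map_in_hardy2: "wold_map X x \<in> hardy2 (op_kernel (cadjoint X))"
  using wold_map_series wold_coeff_in_kernel wold_coeff_square_summable
  unfolding hardy2_def by blast

lemma wold_map_inner: "hardy2_inner (wold_map X x) (wold_map X y) = cinner x y"
  unfolding hardy2_inner_def taylor_coeff_eqI[OF wold_map_series]
  using wold_coeff_sums sums_unique by metis

lemma wold_coeff_eqD:
  assumes "wold_coeff X x = wold_coeff X y"
  shows "x = y"
proof -
  have "wold_coeff X (x - y) m = 0" for m
    using assms by (simp add: clinear_simps(3)[OF wold_coeff_clinear])
  then have "cinner (x - y) (x - y) = 0"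
    using wold_coeff_sums[of "x - y" "x - y"] sums_unique2[OF _ sums_zero] by simp
  then show ?thesis
    by (simp add: cinner_self)
qed

text \<open>Each X* cancels one X until only the vector of ker X* is left; the next X* kills
  it.\<close>

lemma adj_funpow_wandering:
  assumes "\<eta> \<in> op_kernel (cadjoint X)"
  shows "(cadjoint X ^^ k) ((X ^^ m) \<eta>) = (if k \<le> m then (X ^^ (m - k)) \<eta> else 0)"
proof (induction k)
  case (Suc k)
  show ?case
  proof (cases "Suc k \<le> m")
    case True
    then have "(X ^^ (m - k)) \<eta> = X ((X ^^ (m - Suc k)) \<eta>)"
      by (metis Suc_diff_Suc Suc_le_lessD comp_apply funpow.simps(2))
    then show ?thesis
      using Suc True by (simp add: cadjoint_isometry_cancel[OF iso])
  next
    case False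
    then show ?thesis
      using Suc assms by (cases "k = m") (auto simp: op_kernel_def adj_simps)
  qed
qed simp

text \<open>For k < m the vector \<open>(cadjoint X ^^ k) ((X ^^ m) \<eta>)\<close> still lies in
  the range of X, which I - X X* annihilates; for k > m it is already 0.\<close>

lemma wold_coeff_wandering:
  assumes "\<eta> \<in> op_kernel (cadjoint X)"
  shows "wold_coeff X ((X ^^ m) \<eta>) k = (if k = m then \<eta> else 0)"
proof -
  consider "k < m" | "k = m" | "m < k"
    by linarith
  then show ?thesis
  proof cases
    case 1
    then have "(X ^^ (m - k)) \<eta> = X ((X ^^ (m - Suc k)) \<eta>)"
      by (metis Suc_diff_Suc comp_apply funpow.simps(2))
    with 1 show ?thesis
      unfolding wold_coeff_def adj_funpow_wandering[OF assms] by simp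
  next
    case 2
    then show ?thesis
      unfolding wold_coeff_def adj_funpow_wandering[OF assms] by (simp add: X_simps)
  next
    case 3
    then show ?thesis
      unfolding wold_coeff_def adj_funpow_wandering[OF assms] by (simp add: X_simps)
  qed
qed

lemma wold_map_wandering:
  assumes "\<eta> \<in> op_kernel (cadjoint X)"
  shows "wold_map X ((X ^^ m) \<eta>) = disc_monomial m \<eta>"
proof (rule disc_power_series_eqI)
  show "disc_power_series (\<lambda>k. if k = m then \<eta> else 0) (wold_map X ((X ^^ m) \<eta>))"
    using wold_map_series[of "(X ^^ m) \<eta>"] by (simp add: wold_coeff_wandering[OF assms, abs_def])
qed (rule disc_power_series_monomial)

text \<open>Move the larger power to the other side as an adjoint: it strips all factors X there and
  then kills the wandering vector. Conjugate symmetry covers both orders of m and k.\<close>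

lemma wandering_orthogonal:
  assumes "\<eta> \<in> op_kernel (cadjoint X)" "\<xi> \<in> op_kernel (cadjoint X)" "m \<noteq> k"
  shows "cinner ((X ^^ m) \<eta>) ((X ^^ k) \<xi>) = 0"
proof -
  have *: "cinner ((X ^^ m) \<eta>) ((X ^^ k) \<xi>) = 0"
    if "\<eta> \<in> op_kernel (cadjoint X)" "m < k" for m k \<eta> \<xi>
    using that by (simp add: cinner_adj_funpow[symmetric] adj_funpow_wandering)
  show ?thesis
    using *[OF assms(1)] *[OF assms(2)] assms(3)
    by (metis cinner_commute complex_cnj_zero linorder_neqE_nat)
qed

lemma norm_sum_wandering:
  assumes "\<And>m. a m \<in> op_kernel (cadjoint X)" "finite F"
  shows "(norm (\<Sum>m\<in>F. (X ^^ m) (a m)))\<^sup>2 = (\<Sum>m\<in>F. (norm (a m))\<^sup>2)"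
  using assms(2)
proof induction
  case (insert k F)
  have "cinner ((X ^^ k) (a k)) (\<Sum>m\<in>F. (X ^^ m) (a m)) =
      (\<Sum>m\<in>F. cinner ((X ^^ k) (a k)) ((X ^^ m) (a m)))"
    by (rule linear_sum[OF bounded_linear.linear[OF
            bounded_bilinear.bounded_linear_right[OF bounded_bilinear_cinner]]])
  also have "\<dots> = 0"
    using insert.hyps assms(1) by (intro sum.neutral ballI wandering_orthogonal) auto
  finally show ?case
    using insert isometry_funpow[OF iso, of k] by (simp add: norm_power2_add isometry_def)
qed simp

text \<open>The preimage is the sum of the vectors \<open>(X ^^ m) (a m)\<close>. Its partial sums
  are Cauchy by Pythagoras and square summability, and each coefficient, being bounded and linear in
  x, can be taken term by term.\<close>

lemma wold_coeff_surj:
  assumes a: "\<And>m. a m \<in> op_kernel (cadjoint X)" and sq: "summable (\<lambda>m. (norm (a m))\<^sup>2)"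
  shows "\<exists>x. wold_coeff X x = a"
proof
  have summ: "summable (\<lambda>m. (X ^^ m) (a m))"
    unfolding summable_Cauchy
  proof (intro allI impI)
    fix e :: real assume "0 < e"
    then obtain N where N: "\<And>m n. N \<le> m \<Longrightarrow> norm (\<Sum>m\<in>{m..<n}. (norm (a m))\<^sup>2) < e\<^sup>2"
      using sq unfolding summable_Cauchy by (meson zero_less_power)
    have "norm (\<Sum>m\<in>{m..<n}. (X ^^ m) (a m)) < e" if "N \<le> m" for m n
      using N[OF that, of n] \<open>0 < e\<close> norm_sum_wandering[OF a, of "{m..<n}"]
      by (intro power2_less_imp_less[of _ e]) (auto simp: sum_nonneg)
    then show "\<exists>N. \<forall>m\<ge>N. \<forall>n. norm (\<Sum>m\<in>{m..<n}. (X ^^ m) (a m)) < e"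
      by blast
  qed
  show "wold_coeff X (\<Sum>m. (X ^^ m) (a m)) = a"
  proof
    fix k
    have "bounded_linear (\<lambda>x. wold_coeff X x k)"
      using clinear_bounded_linear[OF wold_coeff_clinear, of k 1] norm_wold_coeff_le by simp
    then have "(\<lambda>m. wold_coeff X ((X ^^ m) (a m)) k) sums wold_coeff X (\<Sum>m. (X ^^ m) (a m)) k"
      using bounded_linear.sums summable_sums[OF summ] by blast
    moreover have "wold_coeff X ((X ^^ m) (a m)) k = (if m = k then a m else 0)" for m
      using wold_coeff_wandering[OF a] by auto
    ultimately show "wold_coeff X (\<Sum>m. (X ^^ m) (a m)) k = a k"
      using sums_single[of k a] sums_unique2 by fastforce
  qed
qed

section \<open>The Wold map is unitary and is the only unitary with the prescribed values\<close>

lemma wold_map_clinear: "clinear_on UNIV (wold_map X)"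
proof -
  have s: "(\<lambda>m. z ^ m *\<^sub>C wold_coeff X x m) sums wold_map X x z" if "z \<in> unit_disc" for x z
    using that wold_map_series by (auto simp: disc_power_series_def)
  have out: "wold_map X x z = 0" if "z \<notin> unit_disc" for x z
    using that by (simp add: wold_map_def disc_series_def)
  have "wold_map X (x + y) z = wold_map X x z + wold_map X y z" for x y z
  proof (cases "z \<in> unit_disc")
    case True
    then show ?thesis
      using sums_add[OF s[OF True, of x] s[OF True, of y]] s[OF True, of "x + y"] sums_unique2
      by (simp add: clinear_simps(1)[OF wold_coeff_clinear] scaleC_add_right)
  qed (simp add: out)
  moreover have "wold_map X (c *\<^sub>C x) z = c *\<^sub>C wold_map X x z" for c x z
  proof (cases "z \<in> unit_disc")
    case True
    have "bounded_linear (\<lambda>x::'a. c *\<^sub>C x)"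
      by (rule clinear_bounded_linear[of _ "cmod c"])
        (auto simp: clinear_on_def scaleC_add_right scaleC_scaleC norm_scaleC mult.commute)
    from bounded_linear.sums[OF this s[OF True, of x]] show ?thesis
      using s[OF True, of "c *\<^sub>C x"] sums_unique2
      by (simp add: clinear_simps(2)[OF wold_coeff_clinear] scaleC_scaleC mult.commute)
  qed (simp add: out)
  ultimately show ?thesis
    by (simp add: clinear_on_def fun_eq_iff scaleC_fun_def)
qed

lemma wold_map_unitary:
  "unitary_between UNIV cinner (hardy2 (op_kernel (cadjoint X))) hardy2_inner (wold_map X)"
  unfolding unitary_between_def
proof (intro conjI)
  have "inj (wold_map X)"
    by (rule injI) (metis wold_coeff_eqD taylor_coeff_eqI wold_map_series)
  moreover have "f \<in> range (wold_map X)" if "f \<in> hardy2 (op_kernel (cadjoint X))" for f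
    using that wold_coeff_surj unfolding wold_map_def by (elim hardy2E) (metis rangeI)
  ultimately show "bij_betw (wold_map X) UNIV (hardy2 (op_kernel (cadjoint X)))"
    unfolding bij_betw_def using wold_map_in_hardy2 by blast
qed (simp_all add: wold_map_clinear wold_map_inner)

text \<open>Needed to evaluate the definite description in \<open>wold_decomposition\<close>.
  Instead of a density argument, the Taylor coefficients of P x are read off by pairing it with
  monomials: P preserves inner products, so the pairing with z^m \<eta> equals that of x with
  \<open>(X ^^ m) \<eta>\<close>.\<close>

lemma wold_map_unique:
  assumes "unitary_between UNIV cinner (hardy2 (op_kernel (cadjoint X))) hardy2_inner P"
    and mono: "\<And>m \<eta>. \<eta> \<in> op_kernel (cadjoint X) \<Longrightarrow> P ((X ^^ m) \<eta>) = disc_monomial m \<eta>"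
  shows "P = wold_map X"
proof
  fix x
  have "P x \<in> hardy2 (op_kernel (cadjoint X))"
    and inner: "\<And>x y. hardy2_inner (P x) (P y) = cinner x y"
    using assms(1) by (auto simp: unitary_between_def bij_betw_def)
  then obtain a where a: "disc_power_series a (P x)" "\<And>m. a m \<in> op_kernel (cadjoint X)"
      "taylor_coeff (P x) = a"
    by (elim hardy2E) blast
  have "a m = wold_coeff X x m" for m
  proof -
    have *: "cinner (a m) \<eta> = cinner (wold_coeff X x m) \<eta>"
      if \<eta>: "\<eta> \<in> op_kernel (cadjoint X)" for \<eta>
    proof -
      have "(\<lambda>k. if k = m then cinner (a k) \<eta> else 0) sums cinner (a m) \<eta>"
        by (rule sums_single)
      moreover have "(\<lambda>k. cinner (a k) (if k = m then \<eta> else 0)) =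
          (\<lambda>k. if k = m then cinner (a k) \<eta> else 0)"
        by auto
      ultimately have "cinner (a m) \<eta> = hardy2_inner (P x) (disc_monomial m \<eta>)"
        unfolding hardy2_inner_def a(3) taylor_coeff_eqI[OF disc_power_series_monomial]
        by (simp add: sums_unique)
      also have "\<dots> = cinner x ((X ^^ m) \<eta>)"
        using inner[of x "(X ^^ m) \<eta>"] by (simp add: mono \<eta>)
      also have "\<dots> = cinner (wold_coeff X x m) \<eta>"
        using \<eta> by (simp add: wold_coeff_def cinner_simps cinner_adj_funpow cinner_cadjoint[OF iso]
            op_kernel_def)
      finally show ?thesis .
    qed
    \<comment> \<open>The difference lies in ker X* itself, so it may be tested against
      itself.\<close>
    have "a m - wold_coeff X x m \<in> op_kernel (cadjoint X)"
      using a(2) wold_coeff_in_kernel csubspace_diff csubspace_op_kernel cadjoint_clinear iso by blast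
    from *[OF this] have "cinner (a m - wold_coeff X x m) (a m - wold_coeff X x m) = 0"
      by (simp add: cinner_diff_left)
    then show ?thesis
      by (simp add: cinner_self)
  qed
  then have "a = wold_coeff X x"
    by blast
  then show "P x = wold_map X x"
    using a(1) wold_map_series disc_power_series_eqI by blast
qed

lemma wold_decomposition_eq: "wold_decomposition X = wold_map X"
  unfolding wold_decomposition_def
  by (rule the_equality) (auto intro: wold_map_unitary wold_map_wandering wold_map_unique)

end

section \<open>A commuting factorisation of a shift\<close>

text \<open>Projection-free form of P_W A + B*, equal to it on the whole space and not only on
  W.\<close>

definition factor_unitary :: "('a::complex_hilbert \<Rightarrow> 'a) \<Rightarrow> ('a \<Rightarrow> 'a) \<Rightarrow> 'a \<Rightarrow> 'a" where
  "factor_unitary A B x = A (x - B (cadjoint B x)) + cadjoint B x"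

definition factor_symbol ::
  "('a::complex_hilbert \<Rightarrow> 'a) \<Rightarrow> ('a \<Rightarrow> 'a) \<Rightarrow> complex \<Rightarrow> 'a \<Rightarrow> 'a" where
  "factor_symbol A B z x = A (x - B (cadjoint B x)) + z *\<^sub>C cadjoint B x"

lemma funpow_commute_apply:
  assumes "\<And>x. f (g x) = g (f x)"
  shows "(f ^^ m) (g x) = g ((f ^^ m) x)"
  by (induction m) (simp_all add: assms)

locale commuting_factors =
  fixes A B :: "'a::complex_hilbert \<Rightarrow> 'a"
  assumes isoA: "isometry A" and isoB: "isometry B"
    and commute: "A \<circ> B = B \<circ> A"
    and shift_comp: "shift (A \<circ> B)"
begin

sublocale shift_operator "A \<circ> B"
  by standard (rule shift_comp)

text \<open>Makes every result of this locale available with A and B exchanged; this provides the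
  inverse of the unitary.\<close>

lemma swap: "commuting_factors B A"
  using isoA isoB commute shift_comp by unfold_locales simp_all

lemma commute_apply: "A (B x) = B (A x)"
  using commute by (metis comp_apply)

lemma adj_comp: "cadjoint (A \<circ> B) x = cadjoint B (cadjoint A x)"
  by (rule cadjoint_comp[OF isoA isoB])

lemma adj_commute: "cadjoint A (cadjoint B x) = cadjoint B (cadjoint A x)"
  using cadjoint_comp[OF isoA isoB] cadjoint_comp[OF isoB isoA] commute by metis

lemma linA: "clinear_on UNIV A" and linB: "clinear_on UNIV B"
  using isoA isoB by (auto simp: isometry_def)

lemmas A_simps = clinear_simps[OF linA]
lemmas B_simps = clinear_simps[OF linB]
lemmas adjA_simps = clinear_simps[OF cadjoint_clinear[OF isoA]]
lemmas adjB_simps = clinear_simps[OF cadjoint_clinear[OF isoB]]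

lemmas cancel = cadjoint_isometry_cancel[OF isoA] cadjoint_isometry_cancel[OF isoB]

abbreviation W :: "'a set" where
  "W \<equiv> op_kernel (cadjoint (A \<circ> B))"

section \<open>Invariance of W under the operators involved\<close>

lemma csubspace_W: "csubspace W"
  by (rule csubspace_op_kernel[OF cadjoint_clinear[OF iso]])

lemma W_iff: "x \<in> W \<longleftrightarrow> cadjoint B (cadjoint A x) = 0"
  by (simp add: op_kernel_def adj_comp)

lemma kernel_subset: "op_kernel (cadjoint B) \<subseteq> W"
  unfolding W_iff subset_iff by (simp add: op_kernel_def adj_commute[symmetric] adjA_simps)

lemma adjB_in_W: "x \<in> W \<Longrightarrow> cadjoint B x \<in> W"
  by (simp add: W_iff adj_commute adjB_simps)

text \<open>A* cancels A, and B* annihilates x - B B* x; hence the claim holds for every x.\<close>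

lemma residual_in_W: "A (x - B (cadjoint B x)) \<in> W"
  by (simp add: W_iff cancel adjB_simps)

lemma symbol_in_W: "x \<in> W \<Longrightarrow> factor_symbol A B z x \<in> W"
  unfolding factor_symbol_def
  by (intro csubspace_add csubspace_scaleC csubspace_W residual_in_W adjB_in_W)

lemma unitary_eq_symbol: "factor_unitary A B = factor_symbol A B 1"
  by (simp add: factor_unitary_def factor_symbol_def scaleC_one fun_eq_iff)

section \<open>Boundedness and holomorphy of the symbol\<close>

lemma symbol_clinear: "clinear_on S (factor_symbol A B z)"
proof (rule clinear_on_subset)
  have "factor_symbol A B z (x + y) = factor_symbol A B z x + factor_symbol A B z y" for x y
    unfolding factor_symbol_def
    by (simp add: A_simps B_simps adjB_simps scaleC_add_right algebra_simps)
  moreover have "factor_symbol A B z (c *\<^sub>C x) = c *\<^sub>C factor_symbol A B z x" for c x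
    unfolding factor_symbol_def
    by (simp add: A_simps B_simps adjB_simps scaleC_add_right scaleC_diff_right scaleC_scaleC
        mult.commute)
  ultimately show "clinear_on UNIV (factor_symbol A B z)"
    by (simp add: clinear_on_def)
qed

lemma norm_residual_le: "norm (A (x - B (cadjoint B x))) \<le> 2 * norm x"
proof -
  have "norm (A (x - B (cadjoint B x))) = norm (x - B (cadjoint B x))"
    and "norm (B (cadjoint B x)) = norm (cadjoint B x)"
    using isoA isoB by (auto simp: isometry_def)
  then show ?thesis
    using norm_triangle_ineq4[of x "B (cadjoint B x)"] norm_cadjoint_le[OF isoB, of x] by linarith
qed

lemma norm_symbol_le:
  assumes "z \<in> unit_disc"
  shows "norm (factor_symbol A B z x) \<le> 3 * norm x"
proof -
  have "norm (z *\<^sub>C cadjoint B x) \<le> 1 * norm x"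
    unfolding norm_scaleC using assms norm_cadjoint_le[OF isoB, of x] by (intro mult_mono) auto
  then show ?thesis
    unfolding factor_symbol_def
    using norm_residual_le[of x]
      norm_triangle_ineq[of "A (x - B (cadjoint B x))" "z *\<^sub>C cadjoint B x"] by linarith
qed

lemma symbol_hardy_inf: "factor_symbol A B \<in> hardy_inf W"
  unfolding hardy_inf_def
proof (intro CollectI conjI ballI)
  show "bounded_operator_on W (factor_symbol A B z)" if "z \<in> unit_disc" for z
    using symbol_clinear symbol_in_W norm_symbol_le[OF that]
    unfolding bounded_operator_on_def by blast
  have ball: "{x \<in> W. norm x \<le> 1} \<noteq> {}"
    using csubspace_0[OF csubspace_W] by auto
  show "\<exists>C. \<forall>z\<in>unit_disc. operator_norm_on W (factor_symbol A B z) \<le> C"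
  proof (intro exI ballI)
    fix z :: complex assume "z \<in> unit_disc"
    then show "operator_norm_on W (factor_symbol A B z) \<le> 3"
      unfolding operator_norm_on_def
      by (intro cSUP_least ball) (auto intro: order_trans[OF norm_symbol_le])
  qed
  fix z :: complex
  \<comment> \<open>The symbol is affine in z with slope B*, so B* is the derivative at every point
    and the difference quotient has no error term for h different from 0.\<close>
  have "clinear_on W (cadjoint B)"
    using clinear_on_subset cadjoint_clinear[OF isoB] by blast
  then have "bounded_operator_on W (cadjoint B)"
    unfolding bounded_operator_on_def using adjB_in_W norm_cadjoint_le[OF isoB]
    by (metis image_subsetI mult_1)
  moreover have "operator_norm_on W (\<lambda>x. inverse h *\<^sub>C
      (factor_symbol A B (z + h) x - factor_symbol A B z x) - cadjoint B x) = 0" if "h \<noteq> 0" for h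
    using that ball
    by (simp add: operator_norm_on_def factor_symbol_def scaleC_add_left scaleC_scaleC scaleC_one)
  then have "((\<lambda>h. operator_norm_on W (\<lambda>x. inverse h *\<^sub>C
      (factor_symbol A B (z + h) x - factor_symbol A B z x) - cadjoint B x)) \<longlongrightarrow> 0) (at 0)"
    by (intro tendsto_eventually) (auto simp: eventually_at_filter)
  ultimately show "\<exists>L. bounded_operator_on W L \<and>
      ((\<lambda>h. operator_norm_on W (\<lambda>x. inverse h *\<^sub>C
        (factor_symbol A B (z + h) x - factor_symbol A B z x) - L x)) \<longlongrightarrow> 0) (at 0)"
    by blast
qed

text \<open>Let y be the inner value. Since B* A* x = 0 on W, B* y = x - A A* x and y - B B* y = A*
  x. The two summands of the outer operator are then A A* x and x - A A* x.\<close>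

lemma unitary_inverse:
  assumes "x \<in> W"
  shows "factor_unitary A B (factor_unitary B A x) = x"
proof -
  have 0: "cadjoint B (cadjoint A x) = 0"
    using assms by (simp add: W_iff)
  then show ?thesis
    unfolding factor_unitary_def by (simp add: A_simps B_simps adjB_simps cancel)
qed

text \<open>On W the cross terms vanish: pairing A p with B* y is pairing p with V* y = 0, where V =
  A B. The diagonal terms add up because I - B B* and B B* are complementary orthogonal
  projections.\<close>

lemma unitary_inner:
  assumes "x \<in> W" "y \<in> W"
  shows "cinner (factor_unitary A B x) (factor_unitary A B y) = cinner x y"
proof -
  have orth: "cinner (A p) (cadjoint B y) = 0" if "y \<in> W" for p y
  proof -
    have "cinner (A p) (cadjoint B y) = cinner (B (A p)) y"
      by (simp add: cinner_cadjoint[OF isoB])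
    also have "\<dots> = cinner p (cadjoint (A \<circ> B) y)"
      by (simp add: commute_apply[symmetric] cinner_cadjoint[OF isoA] cinner_cadjoint[OF isoB] adj_comp)
    finally show ?thesis
      using that by (simp add: op_kernel_def)
  qed
  have orth': "cinner (cadjoint B y) (A p) = 0" if "y \<in> W" for p y
    using orth[OF that] by (metis cinner_commute complex_cnj_zero)
  show ?thesis
    unfolding factor_unitary_def cinner_add_left cinner_add_right
      orth[OF assms(2)] orth'[OF assms(1)] isometry_cinner[OF isoA]
    by (simp add: cinner_simps cinner_cadjoint[OF isoB] cinner_cadjoint_left[OF isoB, symmetric]
        adjB_simps cancel)
qed

lemma unitary_between_unitary: "unitary_between W cinner W cinner (factor_unitary A B)"
  unfolding unitary_between_def
proof (intro conjI ballI)
  interpret BA: commuting_factors B A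
    by (rule swap)
  \<comment> \<open>The exchanged locale takes the kernel of the adjoint of
    \<open>B \<circ> A\<close>, which is the same operator as \<open>A \<circ> B\<close>.\<close>
  have W: "BA.W = W"
    by (simp add: commute)
  show "bij_betw (factor_unitary A B) W W"
  proof (rule bij_betw_byWitness[where f' = "factor_unitary B A"])
    show "\<forall>x\<in>W. factor_unitary B A (factor_unitary A B x) = x"
      using BA.unitary_inverse W by blast
    show "\<forall>x\<in>W. factor_unitary A B (factor_unitary B A x) = x"
      using unitary_inverse by blast
    show "factor_unitary A B ` W \<subseteq> W"
      unfolding unitary_eq_symbol using symbol_in_W by blast
    show "factor_unitary B A ` W \<subseteq> W"
      unfolding BA.unitary_eq_symbol using BA.symbol_in_W W by blast
  qed
qed (simp_all add: unitary_eq_symbol[symmetric] symbol_clinear[of _ 1, folded unitary_eq_symbol]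
    unitary_inner)

lemma orth_proj_unitary_eq: "orth_proj W (A x) + cadjoint B x = factor_unitary A B x"
  unfolding orth_proj_ker_cadjoint[OF iso] factor_unitary_def
  by (simp add: adj_comp cancel A_simps)

text \<open>The unitary acts as A on ker B* and as B* on the range of B, so the factor z reaches
  only the summand B* x.\<close>

lemma symbol_eq:
  "factor_unitary A B (orth_proj (op_kernel (cadjoint B)) x
    + z *\<^sub>C (x - orth_proj (op_kernel (cadjoint B)) x)) = factor_symbol A B z x"
  unfolding orth_proj_ker_cadjoint[OF isoB] factor_unitary_def factor_symbol_def
  by (simp add: B_simps adjB_simps A_simps cancel)

text \<open>The right-hand sides are the coefficients of the product of the affine symbol with the
  power series of x. The constant term stands apart because there is no preceding
  coefficient.\<close>

lemma wold_coeff_factor: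
  "wold_coeff (A \<circ> B) (A x) 0 = A (wold_coeff (A \<circ> B) x 0 - B (cadjoint B (wold_coeff (A \<circ> B) x 0)))"
  "wold_coeff (A \<circ> B) (A x) (Suc m) =
    A (wold_coeff (A \<circ> B) x (Suc m) - B (cadjoint B (wold_coeff (A \<circ> B) x (Suc m))))
    + cadjoint B (wold_coeff (A \<circ> B) x m)"
proof -
  show "wold_coeff (A \<circ> B) (A x) 0 =
      A (wold_coeff (A \<circ> B) x 0 - B (cadjoint B (wold_coeff (A \<circ> B) x 0)))"
    by (simp add: wold_coeff_def adj_comp cancel A_simps B_simps adjB_simps commute_apply)
  define y where "y = (cadjoint (A \<circ> B) ^^ m) x"
  have "(cadjoint (A \<circ> B) ^^ m) (cadjoint B x) = cadjoint B y"
    unfolding y_def by (rule funpow_commute_apply) (simp only: adj_comp adj_commute)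
  \<comment> \<open>One factor of V* absorbs A and becomes B*, which commutes with the remaining m
    factors.\<close>
  moreover have "cadjoint (A \<circ> B) (A x) = cadjoint B x"
    by (simp only: adj_comp cancel)
  ultimately have 1: "(cadjoint (A \<circ> B) ^^ Suc m) (A x) = cadjoint B y"
    by (simp only: funpow_Suc_right comp_apply)
  have step: "(cadjoint (A \<circ> B) ^^ Suc k) u = cadjoint B (cadjoint A ((cadjoint (A \<circ> B) ^^ k) u))"
    for k u
    by (simp only: funpow.simps(2) comp_apply[of "cadjoint (A \<circ> B)"] adj_comp)
  show "wold_coeff (A \<circ> B) (A x) (Suc m) =
    A (wold_coeff (A \<circ> B) x (Suc m) - B (cadjoint B (wold_coeff (A \<circ> B) x (Suc m))))
    + cadjoint B (wold_coeff (A \<circ> B) x m)"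
    unfolding wold_coeff_def step[of "Suc m" "A x"] 1
    unfolding step y_def[symmetric]
    by (simp add: adj_commute cancel A_simps B_simps adjB_simps commute_apply)
qed

lemma wold_map_intertwines:
  "wold_map (A \<circ> B) (A x) = mult_op (factor_symbol A B) (wold_map (A \<circ> B) x)"
proof (rule disc_power_series_eqI[OF wold_map_series])
  let ?a = "wold_coeff (A \<circ> B) x"
  let ?R = "\<lambda>x. A (x - B (cadjoint B x))"
  show "disc_power_series (wold_coeff (A \<circ> B) (A x))
      (mult_op (factor_symbol A B) (wold_map (A \<circ> B) x))"
    unfolding disc_power_series_def
  proof (intro conjI ballI allI impI)
    fix z :: complex assume z: "z \<in> unit_disc"
    have s: "(\<lambda>m. z ^ m *\<^sub>C ?a m) sums wold_map (A \<circ> B) x z"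
      using wold_map_series z by (auto simp: disc_power_series_def)
    have "bounded_linear ?R"
      by (rule clinear_bounded_linear[OF _ norm_residual_le])
        (simp add: clinear_on_def A_simps B_simps adjB_simps scaleC_diff_right)
    then have R: "(\<lambda>m. ?R (z ^ m *\<^sub>C ?a m)) sums ?R (wold_map (A \<circ> B) x z)"
      by (rule bounded_linear.sums[OF _ s])
    have "bounded_linear (\<lambda>x. z *\<^sub>C cadjoint B x)"
      using norm_cadjoint_le[OF isoB]
      by (intro clinear_bounded_linear[of _ "cmod z"])
        (auto simp: clinear_on_def adjB_simps scaleC_add_right scaleC_scaleC norm_scaleC
          mult.commute[of _ z] mult_left_mono)
    then have "(\<lambda>m. z *\<^sub>C cadjoint B (z ^ m *\<^sub>C ?a m)) sums
        (z *\<^sub>C cadjoint B (wold_map (A \<circ> B) x z))"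
      by (rule bounded_linear.sums[OF _ s])
    \<comment> \<open>Multiplication by z moves each coefficient up by one index; padding with 0 at
      index 0 lets this series be added termwise to the unshifted one.\<close>
    then have "(\<lambda>m. case m of 0 \<Rightarrow> 0 | Suc m \<Rightarrow> z *\<^sub>C cadjoint B (z ^ m *\<^sub>C ?a m)) sums
        (z *\<^sub>C cadjoint B (wold_map (A \<circ> B) x z))"
      using sums_Suc_iff[of "case_nat 0 (\<lambda>m. z *\<^sub>C cadjoint B (z ^ m *\<^sub>C ?a m))"] by simp
    note sums_add[OF R this]
    moreover have "?R (z ^ m *\<^sub>C ?a m)
        + (case m of 0 \<Rightarrow> 0 | Suc m \<Rightarrow> z *\<^sub>C cadjoint B (z ^ m *\<^sub>C ?a m))
        = z ^ m *\<^sub>C wold_coeff (A \<circ> B) (A x) m" for m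
      by (cases m) (simp_all only: wold_coeff_factor nat.case A_simps B_simps adjB_simps
          scaleC_diff_right scaleC_add_right scaleC_scaleC power_Suc add_0_right)
    ultimately show "(\<lambda>m. z ^ m *\<^sub>C wold_coeff (A \<circ> B) (A x) m) sums
        mult_op (factor_symbol A B) (wold_map (A \<circ> B) x) z"
      using z by (simp add: mult_op_def factor_symbol_def)
  qed (simp add: mult_op_def)
qed

end

section \<open>Products of commuting isometries\<close>

lemma op_prod_Nil: "op_prod V [] = id"
  and op_prod_Cons: "op_prod V (j # js) = V j \<circ> op_prod V js"
  by (simp_all add: op_prod_def)

lemma isometry_op_prod: "(\<And>j. j \<in> set js \<Longrightarrow> isometry (V j)) \<Longrightarrow> isometry (op_prod V js)"
  by (induction js) (simp_all add: op_prod_Nil op_prod_Cons isometry_id isometry_comp)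

lemma op_prod_commute:
  assumes "\<And>j. j \<in> set js \<Longrightarrow> T \<circ> V j = V j \<circ> T"
  shows "T \<circ> op_prod V js = op_prod V js \<circ> T"
  using assms
proof (induction js)
  case (Cons j js)
  have "T \<circ> op_prod V (j # js) = (V j \<circ> T) \<circ> op_prod V js"
    unfolding op_prod_Cons comp_assoc[symmetric] by (simp only: Cons.prems[of j] list.set_intros)
  also have "\<dots> = op_prod V (j # js) \<circ> T"
    unfolding op_prod_Cons comp_assoc using Cons by (metis list.set_intros(2))
  finally show ?case .
qed (simp add: op_prod_Nil)

text \<open>V i is moved to the front past the factors that precede it. Distinctness ensures that
  the filter deletes exactly one occurrence.\<close>

lemma op_prod_remove:
  assumes "distinct js" "i \<in> set js" "\<And>j. j \<in> set js \<Longrightarrow> V i \<circ> V j = V j \<circ> V i"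
  shows "op_prod V js = V i \<circ> op_prod V (filter (\<lambda>j. j \<noteq> i) js)"
  using assms
proof (induction js)
  case (Cons j js)
  show ?case
  proof (cases "j = i")
    case True
    with Cons.prems have "filter (\<lambda>j. j \<noteq> i) js = js"
      by (auto simp: filter_id_conv)
    with True show ?thesis
      by (simp add: op_prod_Cons)
  next
    case False
    with Cons have "op_prod V js = V i \<circ> op_prod V (filter (\<lambda>j. j \<noteq> i) js)"
      by (metis distinct.simps(2) list.set_intros(2) set_ConsD)
    then have "op_prod V (j # js) = (V j \<circ> V i) \<circ> op_prod V (filter (\<lambda>j. j \<noteq> i) js)"
      by (simp only: op_prod_Cons comp_assoc)
    also have "V j \<circ> V i = V i \<circ> V j"
      using Cons.prems(3)[of j] by (simp only: list.set_intros)
    finally show ?thesis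
      using False by (simp only: op_prod_Cons comp_assoc filter.simps if_True simp_thms)
  qed
qed simp

lemma n_isometry_factors:
  assumes "n_isometry n Vs" "i \<in> {1..n}"
  shows "full_product n Vs = Vs i \<circ> product_omitting n Vs i"
    and "commuting_factors (Vs i) (product_omitting n Vs i)"
proof -
  have iso: "isometry (Vs j)" if "j \<in> {1..n}" for j
    using that assms by (simp add: n_isometry_def)
  have comm: "Vs i \<circ> Vs j = Vs j \<circ> Vs i" if "j \<in> {1..n}" for j
    using that assms unfolding n_isometry_def by blast
  show eq: "full_product n Vs = Vs i \<circ> product_omitting n Vs i"
    unfolding full_product_def product_omitting_def
    using assms comm by (intro op_prod_remove) auto
  show "commuting_factors (Vs i) (product_omitting n Vs i)"
  proof
    show "isometry (Vs i)"
      using iso assms by blast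
    show "isometry (product_omitting n Vs i)"
      unfolding product_omitting_def using iso by (intro isometry_op_prod) auto
    show "Vs i \<circ> product_omitting n Vs i = product_omitting n Vs i \<circ> Vs i"
      unfolding product_omitting_def using comm by (intro op_prod_commute) auto
    show "shift (Vs i \<circ> product_omitting n Vs i)"
      using assms eq by (simp add: n_isometry_def)
  qed
qed

section \<open>The model of an n-isometry, assembled from its two-factor splittings\<close>

theorem theorem2p1:
  fixes n :: nat
    and Vs Vt U :: "nat \<Rightarrow> 'a::complex_hilbert \<Rightarrow> 'a"
    and V :: "'a \<Rightarrow> 'a"
    and W :: "'a set"
    and Wt :: "nat \<Rightarrow> 'a set"
    and \<Phi> :: "nat \<Rightarrow> complex \<Rightarrow> 'a \<Rightarrow> 'a"
  assumes n: "n \<ge> 2"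
    and n_isometry: "n_isometry n Vs"
    and V: "V = full_product n Vs"
    and W: "W = op_kernel (cadjoint V)"
    and Vt: "Vt = product_omitting n Vs"
    and Wt: "\<And>i. Wt i = op_kernel (cadjoint (Vt i))"
    and U: "\<And>i x. U i x = orth_proj W (Vs i x) + cadjoint (Vt i) x"
    and \<Phi>: "\<And>i z x. \<Phi> i z x = U i (orth_proj (Wt i) x + z *\<^sub>C (x - orth_proj (Wt i) x))"
  shows "(\<forall>i\<in>{1..n}.
            Wt i \<subseteq> W \<and>
            unitary_between W cinner W cinner (U i) \<and>
            \<Phi> i \<in> hardy_inf W \<and>
            wold_decomposition V \<circ> Vs i = mult_op (\<Phi> i) \<circ> wold_decomposition V) \<and>
         unitarily_equivalent n UNIV cinner Vs (hardy2 W) hardy2_inner (\<lambda>i. mult_op (\<Phi> i))"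
proof -
  interpret V: shift_operator V
    using n_isometry V by unfold_locales (simp add: n_isometry_def)
  have i: "Wt i \<subseteq> W" "unitary_between W cinner W cinner (U i)" "\<Phi> i \<in> hardy_inf W"
    "wold_decomposition V \<circ> Vs i = mult_op (\<Phi> i) \<circ> wold_decomposition V" if "i \<in> {1..n}" for i
  proof -
    interpret VV: commuting_factors "Vs i" "Vt i"
      using n_isometry_factors(2)[OF n_isometry that] Vt by simp
    have VAB: "V = Vs i \<circ> Vt i"
      using n_isometry_factors(1)[OF n_isometry that] V Vt by simp
    \<comment> \<open>The projection formulas agree with their projection-free forms on the whole
      space, so U i and \<Phi> i are identified as functions.\<close>
    have Ui: "U i = factor_unitary (Vs i) (Vt i)"
      using VV.orth_proj_unitary_eq by (simp add: fun_eq_iff U W VAB)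
    have \<Phi>i: "\<Phi> i = factor_symbol (Vs i) (Vt i)"
      using VV.symbol_eq by (simp add: fun_eq_iff \<Phi> Ui Wt)
    show "Wt i \<subseteq> W"
      using VV.kernel_subset by (simp add: Wt W VAB)
    show "unitary_between W cinner W cinner (U i)"
      using VV.unitary_between_unitary by (simp add: Ui W VAB)
    show "\<Phi> i \<in> hardy_inf W"
      using VV.symbol_hardy_inf by (simp add: \<Phi>i W VAB)
    show "wold_decomposition V \<circ> Vs i = mult_op (\<Phi> i) \<circ> wold_decomposition V"
      using VV.wold_map_intertwines
      by (simp add: fun_eq_iff V.wold_decomposition_eq[unfolded VAB] VAB \<Phi>i)
  qed
  moreover have "unitarily_equivalent n UNIV cinner Vs (hardy2 W) hardy2_inner
      (\<lambda>i. mult_op (\<Phi> i))"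
    unfolding unitarily_equivalent_def
  proof (intro exI conjI ballI)
    \<comment> \<open>The Wold decomposition of V does not depend on i, so this single unitary
      intertwines all n pairs of operators.\<close>
    show "unitary_between UNIV cinner (hardy2 W) hardy2_inner (wold_decomposition V)"
      using V.wold_map_unitary by (simp add: V.wold_decomposition_eq W)
    show "wold_decomposition V (Vs i x) = mult_op (\<Phi> i) (wold_decomposition V x)"
      if "i \<in> {1..n}" for i x
      using i(4)[OF that] by (simp add: fun_eq_iff)
  qed
  ultimately show ?thesis
    by blast
qed

end
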